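(* Let $S=\langle T\rangle$ be a free numerical semigroup generated by a telescopic sequence $T=(t_0,\dots,t_k)$ (with $\gcd(T)=1$). Assume that there is exactly one index $m\in\{0,\dots,k\}$ such that $t_m$ is odd. Then \[ O(G(S))-E(G(S)) = \frac{t_m-1}{2}. \]
   Context: $\mathbb{N}_0$ denotes the set of nonnegative integers. A numerical semigroup $S$ is a submonoid of $(\mathbb{N}_0,+)$ with finite complement; $G(S)=\mathbb{N}_0\setminus S$ is its (finite) set of gaps. For positive integers $n_1,\dots,n_r$, $\langle n_1,\dots,n_r\rangle$ is the set of all $\mathbb{N}_0$-linear combinations of $n_1,\dots,n_r$; it is a numerical semigroup iff $\gcd(n_1,\dots,n_r)=1$. Telescopic sequence: let $k\in\mathbb{N}_0$ and let $T=(t_0,\dots,t_k)$ be a sequence of positive integers. For $0\le i\le k$ let $T_i=(t_0,\dots,t_i)$ and $d_i=\gcd(T_i)=\gcd(t_0,\dots,t_i)$. For $1\le j\le k$ let $c_j=d_{j-1}/d_j$. $T$ is telescopic if $c_jt_j\in\langle T_{j-1}\rangle=\langle t_0,\dots,t_{j-1}\rangle$ for all $j=1,\dots,k$. If $T$ is telescopic and $\gcd(T)=1$, then $\langle T\rangle$ is called a free numerical semigroup. For a finite set $X$ of integers, $O(X)$ (resp. $E(X)$) is the number of odd (resp. even) integers in $X$. *)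

theory Defs
  imports Complex_Main
begin

definition generated :: "nat list \<Rightarrow> nat set" where
  "generated T = {\<Sum>i<length T. a i * T ! i | a :: nat \<Rightarrow> nat. True}"

definition gaps :: "nat set \<Rightarrow> nat set" where
  "gaps S = UNIV - S"

text \<open>A sequence \<open>(t\<^sub>0, \<dots>, t\<^sub>k)\<close> is a nonempty list \<open>T\<close> with \<open>k = length T - 1\<close>;
  its initial part \<open>(t\<^sub>0, \<dots>, t\<^sub>i)\<close> is \<open>take (Suc i) T\<close>.\<close>

definition gcd_upto :: "nat list \<Rightarrow> nat \<Rightarrow> nat" where
  "gcd_upto T i = Gcd (set (take (Suc i) T))"

text \<open>The division is exact, since \<open>gcd_upto T j\<close> divides \<open>gcd_upto T (j - 1)\<close>.
  Only indices \<open>1 \<le> j < length T\<close> are meaningful.\<close>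

definition gcd_ratio :: "nat list \<Rightarrow> nat \<Rightarrow> nat" where
  "gcd_ratio T j = gcd_upto T (j - 1) div gcd_upto T j"

definition telescopic :: "nat list \<Rightarrow> bool" where
  "telescopic T \<longleftrightarrow>
     T \<noteq> [] \<and> (\<forall>t \<in> set T. 0 < t) \<and>
     (\<forall>j. 1 \<le> j \<and> j < length T \<longrightarrow> gcd_ratio T j * T ! j \<in> generated (take j T))"

text \<open>The two counts are meant for finite \<open>X\<close> only (\<^const>\<open>card\<close> of an infinite set is 0).
  The gaps of \<open>generated T\<close> are finite whenever the entries of \<open>T\<close> have gcd 1.\<close>

definition num_odd :: "nat set \<Rightarrow> nat" where
  "num_odd X = card {x \<in> X. odd x}"

definition num_even :: "nat set \<Rightarrow> nat" where
  "num_even X = card {x \<in> X. even x}"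

end

(* An odd element x of S uses the odd generator t at least once, so x - t lies in S. Hence the odd
   gaps are the (t - 1) / 2 odd numbers below t together with the translates by t of the even gaps. *)
theory Submission
  imports Defs
begin

lemma zero_in_generated: "0 \<in> generated T"
  unfolding generated_def by (intro CollectI exI[of _ "\<lambda>_. 0"]) simp

lemma generated_add:
  assumes "x \<in> generated T" "y \<in> generated T"
  shows "x + y \<in> generated T"
proof -
  obtain a b where "x = (\<Sum>i<length T. a i * T ! i)" "y = (\<Sum>i<length T. b i * T ! i)"
    using assms by (auto simp: generated_def)
  hence "x + y = (\<Sum>i<length T. (a i + b i) * T ! i)"
    by (simp add: sum.distrib algebra_simps)
  thus ?thesis
    unfolding generated_def by (intro CollectI exI[of _ "\<lambda>i. a i + b i"]) simp
qed

lemma nth_in_generated: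
  assumes "j < length T"
  shows "T ! j \<in> generated T"
proof -
  have "(\<Sum>i<length T. (if i = j then 1 else 0) * T ! i) = (\<Sum>i<length T. if i = j then T ! i else 0)"
    by (rule sum.cong) auto
  also have "\<dots> = T ! j"
    using assms by simp
  finally show ?thesis
    unfolding generated_def by (intro CollectI exI[of _ "\<lambda>i. if i = j then 1 else 0"]) simp
qed

lemma multiple_mem_submonoid:
  fixes S :: "nat set"
  assumes "0 \<in> S" "\<And>x y. x \<in> S \<Longrightarrow> y \<in> S \<Longrightarrow> x + y \<in> S" "x \<in> S"
  shows "n * x \<in> S"
  by (induction n) (auto simp: assms)

lemma Gcd_difference_submonoid:
  fixes S :: "nat set"
  assumes S: "0 \<in> S" "\<And>x y. x \<in> S \<Longrightarrow> y \<in> S \<Longrightarrow> x + y \<in> S"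
    and "finite A" "A \<subseteq> S"
  shows "\<exists>v\<in>S. v + Gcd A \<in> S"
  using \<open>finite A\<close> \<open>A \<subseteq> S\<close>
proof (induction A rule: finite_induct)
  case empty
  show ?case using S(1) by auto
next
  case (insert a A)
  then obtain v where v: "v \<in> S" "v + Gcd A \<in> S"
    by auto
  show ?case
  proof (cases "a = 0")
    case True
    thus ?thesis using v by auto
  next
    case False
    then obtain p q where pq: "a * p = Gcd A * q + gcd a (Gcd A)"
      using bezout_nat by blast
    \<comment> \<open>The new witness is \<open>q * (v + Gcd A)\<close>: adding \<open>q * v\<close>
      to both sides of the Bezout relation absorbs the term \<open>Gcd A * q\<close>, which need not
      lie in \<open>S\<close>.\<close>
    have "q * (v + Gcd A) \<in> S" "p * a + q * v \<in> S"
      using multiple_mem_submonoid[OF S] insert.prems v S(2) by auto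
    moreover have "p * a + q * v = q * (v + Gcd A) + Gcd (insert a A)"
      using pq by (simp add: algebra_simps)
    ultimately show ?thesis by metis
  qed
qed

text \<open>If n = q b + r with r \<le> q, then n = (q - r) b + r (b + 1) is a combination of the
  two consecutive elements. This covers every n \<ge> b^2.\<close>

lemma finite_gaps_submonoid:
  assumes S: "0 \<in> S" "\<And>x y. x \<in> S \<Longrightarrow> y \<in> S \<Longrightarrow> x + y \<in> S"
    and b: "b \<in> S" "b + 1 \<in> S"
  shows "finite (gaps S)"
proof -
  have "n \<in> S" if "b * b \<le> n" for n
  proof -
    \<comment> \<open>The remainder is below \<open>b\<close>, and the quotient is at least
      \<open>b\<close> because \<open>b * b \<le> n\<close>.\<close>
    have "n mod b \<le> n div b" if "b > 0"
      using \<open>b * b \<le> n\<close> that mod_less_divisor[OF that, of n]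
      by (simp add: less_eq_div_iff_mult_less_eq order.trans[OF less_imp_le])
    \<comment> \<open>For \<open>b = 0\<close> the conventions \<open>n div 0 = 0\<close> and
      \<open>n mod 0 = n\<close> reduce this to n * 1 = n.\<close>
    hence "(n div b - n mod b) * b + n mod b * (b + 1) = n"
      by (cases "b = 0") (simp_all add: diff_mult_distrib algebra_simps)
    thus ?thesis
      using S(2) multiple_mem_submonoid[OF S] b by metis
  qed
  hence "gaps S \<subseteq> {..<b * b}"
    unfolding gaps_def using not_le by auto
  thus ?thesis
    by (rule finite_subset) simp
qed

lemma finite_gaps_generated:
  assumes "Gcd (set T) = 1"
  shows "finite (gaps (generated T))"
proof -
  have "set T \<subseteq> generated T"
    by (auto simp: in_set_conv_nth nth_in_generated)
  then obtain b where "b \<in> generated T" "b + 1 \<in> generated T"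
    using Gcd_difference_submonoid[of "generated T" "set T"] assms
    by (auto simp: zero_in_generated generated_add)
  thus ?thesis
    by (intro finite_gaps_submonoid) (auto simp: zero_in_generated generated_add)
qed

lemma odd_generated_remove:
  assumes "m < length T" "\<And>i. i < length T \<Longrightarrow> odd (T ! i) \<Longrightarrow> i = m"
    and "x \<in> generated T" "odd x"
  shows "\<exists>y\<in>generated T. x = y + T ! m"
proof -
  obtain a where a: "x = (\<Sum>i<length T. a i * T ! i)"
    using assms(3) by (auto simp: generated_def)
  have "a m \<noteq> 0"
  proof
    assume "a m = 0"
    hence "even (a i * T ! i)" if "i < length T" for i
      using assms(2)[of i] that by fastforce
    hence "even x"
      unfolding a by (intro dvd_sum) auto
    thus False using \<open>odd x\<close> by simp
  qed
  \<comment> \<open>One copy of \<open>T ! m\<close> is taken out; the subtraction does not truncate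
    since \<open>a m \<noteq> 0\<close>.\<close>
  let ?a = "a(m := a m - 1)"
  have "x = a m * T ! m + (\<Sum>i\<in>{..<length T} - {m}. a i * T ! i)"
    unfolding a using assms(1) by (intro sum.remove) auto
  also have "(\<Sum>i\<in>{..<length T} - {m}. a i * T ! i) = (\<Sum>i\<in>{..<length T} - {m}. ?a i * T ! i)"
    by (rule sum.cong) auto
  also have "a m * T ! m = ?a m * T ! m + T ! m"
    using \<open>a m \<noteq> 0\<close> by (cases "a m") auto
  also have "?a m * T ! m + T ! m + (\<Sum>i\<in>{..<length T} - {m}. ?a i * T ! i)
      = (\<Sum>i<length T. ?a i * T ! i) + T ! m"
    using assms(1) by (subst sum.remove[of "{..<length T}" m]) auto
  finally show ?thesis
    by (auto simp: generated_def)
qed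

text \<open>Translation by \<open>t\<close> matches the even gaps with the odd gaps that are at
  least \<open>t\<close>: \<open>add\<close> gives one direction, \<open>remove\<close> the
  other.\<close>

lemma num_odd_gaps:
  fixes t :: nat
  assumes "finite (gaps S)" "odd t"
    and add: "\<And>y. y \<in> S \<Longrightarrow> y + t \<in> S"
    and remove: "\<And>x. x \<in> S \<Longrightarrow> odd x \<Longrightarrow> \<exists>y\<in>S. x = y + t"
  shows "num_odd (gaps S) = (t - 1) div 2 + num_even (gaps S)"
proof -
  let ?E = "{x \<in> gaps S. even x}" and ?L = "{x. x < t \<and> odd x}"
  have "{x \<in> gaps S. odd x} = ?L \<union> (\<lambda>x. x + t) ` ?E"
  proof (intro equalityI subsetI)
    fix x assume x: "x \<in> {x \<in> gaps S. odd x}"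
    show "x \<in> ?L \<union> (\<lambda>x. x + t) ` ?E"
    proof (cases "x < t")
      case True
      thus ?thesis using x by simp
    next
      case False
      hence "x = (x - t) + t" by simp
      \<comment> \<open>If \<open>x - t\<close> were in \<open>S\<close>, then \<open>add\<close>
        would put the gap \<open>x\<close> in \<open>S\<close>.\<close>
      moreover have "x - t \<in> ?E"
        using x False add[of "x - t"] \<open>odd t\<close> by (auto simp: gaps_def)
      ultimately show ?thesis by blast
    qed
  next
    fix x assume "x \<in> ?L \<union> (\<lambda>x. x + t) ` ?E"
    thus "x \<in> {x \<in> gaps S. odd x}"
      \<comment> \<open>An odd \<open>x\<close> in \<open>S\<close> would be y + t with y in
        \<open>S\<close>: impossible for \<open>x < t\<close>, and contradictory when
        \<open>x\<close> is the translate of a gap.\<close>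
      using remove[of x] \<open>odd t\<close> by (auto simp: gaps_def)
  qed
  moreover have "?L = (\<lambda>i. 2 * i + 1) ` {..<(t - 1) div 2}"
    using \<open>odd t\<close> by (auto elim!: oddE simp: image_iff)
  hence "card ?L = (t - 1) div 2"
    by (simp add: card_image inj_on_def)
  moreover have "card ((\<lambda>x. x + t) ` ?E) = card ?E"
    by (simp add: card_image)
  \<comment> \<open>The union is disjoint: translates are at least \<open>t\<close>, members of
    \<open>?L\<close> are below it.\<close>
  moreover have "card (?L \<union> (\<lambda>x. x + t) ` ?E) = card ?L + card ((\<lambda>x. x + t) ` ?E)"
    using assms(1) by (intro card_Un_disjoint) auto
  ultimately show ?thesis
    by (simp add: num_odd_def num_even_def)
qed

theorem corollary3p6:
  fixes T :: "nat list" and S :: "nat set" and m :: nat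
  assumes "telescopic T"
    and "Gcd (set T) = 1"
    and "S = generated T"
    and "m < length T" and "odd (T ! m)"
    and "\<And>i. i < length T \<Longrightarrow> odd (T ! i) \<Longrightarrow> i = m"
  shows "real (num_odd (gaps S)) - real (num_even (gaps S)) = (real (T ! m) - 1) / 2"
proof -
  have "num_odd (gaps S) = (T ! m - 1) div 2 + num_even (gaps S)"
    unfolding \<open>S = generated T\<close>
    using assms(2,4-) 
    by (intro num_odd_gaps finite_gaps_generated odd_generated_remove generated_add nth_in_generated)
  \<comment> \<open>Oddness makes the natural-number division exact and keeps
    \<open>T ! m - 1\<close> from truncating.\<close>
  moreover have "real ((T ! m - 1) div 2) = (real (T ! m) - 1) / 2"
    using \<open>odd (T ! m)\<close> by (auto elim!: oddE)
  ultimately show ?thesis by simp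
qed

end
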